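(* Let $f,g:\mathbb{N}\to\mathbb{C}$ and $z\in\mathbb{C}$ be such that the double series $\sum_{m=1}^\infty\sum_{n=1}^\infty\frac{f(m)g(n)}{\xi(m)\xi(n)}z^{mn}$ converges absolutely. Then $$\widetilde{P}(f\circ g,z)=\sum_{k=1}^\infty\frac{f(k)}{\xi(k)}\widetilde{P}(g,z^k),$$ the convergence being absolute. (The identity also holds formally, as power series in $z$.)
   Context: For $n\in\mathbb{N}$ write $n=\prod_p p^{\nu_p(n)}$ and $\xi(n)=\prod_p\nu_p(n)!$. The binomial convolution is $(f\circ g)(n)=\sum_{d\mid n}\left(\prod_p\binom{\nu_p(n)}{\nu_p(d)}\right)f(d)g(n/d)$. The exponential generating function of $f$ is $\widetilde{P}(f,z)=\sum_{n=1}^\infty\frac{f(n)}{\xi(n)}z^n$. *)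

theory Defs
  imports "HOL-Analysis.Analysis" "HOL-Computational_Algebra.Computational_Algebra"
begin

text \<open>Arithmetic functions are rendered as functions on \<^typ>\<open>nat\<close>; only their values at positive
  arguments are ever used. Products over all primes are restricted to the prime factors of \<open>n\<close>,
  since for every other prime the factor is \<open>0! = 1\<close>, respectively \<open>0 choose 0 = 1\<close>.\<close>

definition xi :: "nat \<Rightarrow> nat" where
  "xi n = (\<Prod>p\<in>prime_factors n. fact (multiplicity p n))"

definition binom_conv :: "(nat \<Rightarrow> complex) \<Rightarrow> (nat \<Rightarrow> complex) \<Rightarrow> nat \<Rightarrow> complex" where
  "binom_conv f g n =
     (\<Sum>d | d dvd n.
        of_nat (\<Prod>p\<in>prime_factors n. multiplicity p n choose multiplicity p d) * f d * g (n div d))"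

definition egf_term :: "(nat \<Rightarrow> complex) \<Rightarrow> complex \<Rightarrow> nat \<Rightarrow> complex" where
  "egf_term f z n = f n / of_nat (xi n) * z ^ n"

text \<open>The summation starts at \<open>n = 1\<close>, hence the shift by \<^const>\<open>Suc\<close>.\<close>

definition egf :: "(nat \<Rightarrow> complex) \<Rightarrow> complex \<Rightarrow> complex" where
  "egf f z = (\<Sum>n. egf_term f z (Suc n))"

definition formal_egf :: "(nat \<Rightarrow> complex) \<Rightarrow> complex fps" where
  "formal_egf f = Abs_fps (\<lambda>n. if n = 0 then 0 else f n / of_nat (xi n))"

text \<open>In the formal identity, \<open>fps_compose (formal_egf g) (fps_X ^ k)\<close> is the generating function of \<open>g\<close> with
  \<open>X\<^sup>k\<close> substituted for \<open>X\<close>, and infinite sums of formal power series are taken in the \<open>X\<close>-adic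
  metric, so that every coefficient is eventually constant along the partial sums.\<close>

end

theory Submission
  imports Defs
begin

text \<open>Since \<open>\<nu>\<^sub>p(n) = \<nu>\<^sub>p(d) + \<nu>\<^sub>p(n/d)\<close>, the binomial weights are exactly
  \<open>\<xi>(n) / (\<xi>(d) \<xi>(n/d))\<close>, so \<open>f \<mapsto> f/\<xi>\<close> turns the binomial convolution into the Dirichlet
  convolution. Both sides of the identity are then rearrangements of the same double series, summed
  along the hyperbolas \<open>mn = const\<close> or along the rows.\<close>

lemma xi_nonzero [simp]: "xi n \<noteq> 0"
  by (simp add: xi_def)

text \<open>Primes of \<open>n\<close> that do not divide \<open>d\<close> contribute
  \<open>0! = 1\<close>. This gives \<open>xi n\<close>, \<open>xi d\<close> and
  \<open>xi (n div d)\<close> a common index set, so they can be compared prime by prime.\<close>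

lemma xi_eq_prod_superset:
  assumes "n > 0" "d dvd n"
  shows "xi d = (\<Prod>p\<in>prime_factors n. fact (multiplicity p d))"
  unfolding xi_def
proof (rule prod.mono_neutral_left)
  show "prime_factors d \<subseteq> prime_factors n"
    using assms by (intro dvd_prime_factors) auto
qed (simp, auto simp: prime_factors_multiplicity)

text \<open>At each prime this is \<open>a! * b! * ((a + b) choose a) = (a + b)!\<close>, because
  multiplicities add along \<open>n = d * e\<close>. The product form keeps it free of division in
  the naturals.\<close>

lemma prod_binomial_mult_xi:
  assumes "n > 0" "d dvd n"
  shows "(\<Prod>p\<in>prime_factors n. multiplicity p n choose multiplicity p d) * (xi d * xi (n div d)) = xi n"
proof -
  obtain e where n: "n = d * e" using assms(2) by blast
  with assms have pos: "d > 0" "e > 0" by auto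
  have e: "n div d = e" using n pos by simp
  have "xi d * xi e * (\<Prod>p\<in>prime_factors n. multiplicity p n choose multiplicity p d) =
      (\<Prod>p\<in>prime_factors n. fact (multiplicity p d) * fact (multiplicity p e) *
        (multiplicity p n choose multiplicity p d))"
    using xi_eq_prod_superset[OF assms(1), of d] xi_eq_prod_superset[OF assms(1), of e] n
    by (simp add: prod.distrib)
  also have "\<dots> = (\<Prod>p\<in>prime_factors n. fact (multiplicity p n))"
  proof (rule prod.cong)
    fix p assume "p \<in> prime_factors n"
    then have "multiplicity p n = multiplicity p d + multiplicity p e"
      using pos by (simp add: n prime_elem_multiplicity_mult_distrib in_prime_factors_iff)
    then show "fact (multiplicity p d) * fact (multiplicity p e) *
        (multiplicity p n choose multiplicity p d) = fact (multiplicity p n)"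
      using binomial_fact_lemma[of "multiplicity p d" "multiplicity p n"] by simp
  qed simp
  also have "\<dots> = xi n"
    by (simp add: xi_def)
  finally show ?thesis
    by (simp add: e mult.commute)
qed

lemma binom_conv_div_xi:
  assumes "n > 0"
  shows "binom_conv f g n / of_nat (xi n) =
    (\<Sum>d | d dvd n. f d / of_nat (xi d) * (g (n div d) / of_nat (xi (n div d))))"
  unfolding binom_conv_def sum_divide_distrib
proof (rule sum.cong)
  fix d assume "d \<in> {d. d dvd n}"
  then have "of_nat (xi n) =
      (of_nat (\<Prod>p\<in>prime_factors n. multiplicity p n choose multiplicity p d) :: complex) *
      (of_nat (xi d) * of_nat (xi (n div d)))" (is "_ = ?c * _")
    using prod_binomial_mult_xi[OF assms, of d] by (metis mem_Collect_eq of_nat_mult)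
  \<comment> \<open>A zero weight would force \<open>xi n = 0\<close>; nonvanishing lets the weight
    be cancelled from the quotient.\<close>
  moreover from this have "?c \<noteq> 0"
    by (metis mult_zero_left of_nat_eq_0_iff xi_nonzero)
  ultimately show "?c * f d * g (n div d) / of_nat (xi n) =
      f d / of_nat (xi d) * (g (n div d) / of_nat (xi (n div d)))"
    by (simp add: field_simps del: of_nat_prod)
qed simp

text \<open>Each inner sum is bounded in norm by the inner sum of norms, and these are summable by
  Fubini. Applied once to rows and once to hyperbolas, it gives both absolute convergence claims for
  the outer series.\<close>

lemma abs_summable_on_infsum_Sigma:
  fixes h :: "'a \<times> 'b \<Rightarrow> 'c :: banach"
  assumes "(\<lambda>x. norm (h x)) summable_on Sigma A B"
  shows "(\<lambda>x. norm (infsum (\<lambda>y. h (x, y)) (B x))) summable_on A"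
proof (rule Infinite_Sum.abs_summable_on_comparison_test)
  show "(\<lambda>x. norm (infsum (\<lambda>y. norm (h (x, y))) (B x))) summable_on A"
    using assms by (subst (asm) Infinite_Sum.abs_summable_on_Sigma_iff) blast
  fix x assume "x \<in> A"
  then have "(\<lambda>y. norm (h (x, y))) summable_on B x"
    using assms by (subst (asm) Infinite_Sum.abs_summable_on_Sigma_iff) blast
  then show "norm (infsum (\<lambda>y. h (x, y)) (B x)) \<le> norm (infsum (\<lambda>y. norm (h (x, y))) (B x))"
    using norm_infsum_bound by (metis abs_ge_self order_trans real_norm_def)
qed

lemma bij_betw_Suc_atLeast_1: "bij_betw Suc UNIV {1..}"
  by (rule bij_betwI[where g = "\<lambda>n. n - 1"]) auto

text \<open>Translates between unordered sums over \<open>{1..}\<close>, where regrouping is free,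
  and the series shifted by \<open>Suc\<close>; for nonnegative terms the two kinds of summability
  agree.\<close>

lemma abs_summable_on_atLeast_1_iff:
  "(\<lambda>n. norm (a n)) summable_on {1..} \<longleftrightarrow> summable (\<lambda>n. norm (a (Suc n)))"
  using summable_on_reindex_bij_betw[OF bij_betw_Suc_atLeast_1, of "\<lambda>n. norm (a n)"]
    summable_on_UNIV_nonneg_real_iff[of "\<lambda>n. norm (a (Suc n))"]
  by simp

lemma infsum_atLeast_1:
  fixes a :: "nat \<Rightarrow> 'a :: banach"
  assumes "(\<lambda>n. norm (a n)) summable_on {1..}"
  shows "infsum a {1..} = (\<Sum>n. a (Suc n))"
proof -
  have "(\<lambda>n. a (Suc n)) summable_on UNIV"
    using abs_summable_summable[OF assms] summable_on_reindex_bij_betw[OF bij_betw_Suc_atLeast_1]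
    by blast
  then have "(\<lambda>n. a (Suc n)) sums infsum (\<lambda>n. a (Suc n)) UNIV"
    by (intro has_sum_imp_sums has_sum_infsum)
  then show ?thesis
    using infsum_reindex_bij_betw[OF bij_betw_Suc_atLeast_1, of a] by (simp add: sums_iff)
qed

text \<open>A divisor \<open>d\<close> of \<open>n\<close> is the same as a factorization
  \<open>n = d * (n div d)\<close>, so the hyperbolas partition the quadrant of positive
  pairs.\<close>

lemma bij_betw_divisor_pairs:
  "bij_betw (\<lambda>(n, d). (d, n div d)) (SIGMA n:{1..}. {d. d dvd n}) ({1..} \<times> {1::nat..})"
  by (rule bij_betwI[where g = "\<lambda>(m, n). (m * n, m)"])
    (auto simp: Suc_le_eq elim!: dvdE intro!: Nat.gr0I)

lemma formal_egf_compose_X_power_nth: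
  assumes "k > 0"
  shows "fps_nth (fps_compose (formal_egf g) (fps_X ^ k)) n =
    (if n > 0 \<and> k dvd n then g (n div k) / of_nat (xi (n div k)) else 0)"
  using assms by (auto simp: fps_nth_compose_X_power formal_egf_def elim!: dvdE)

text \<open>The summand with index \<open>d = Suc k\<close> reaches the coefficient at
  \<open>n\<close> only if \<open>d\<close> divides \<open>n\<close>, so that coefficient is final
  once all \<open>d\<close> \<le> \<open>n\<close> have been added.\<close>

lemma formal_egf_binom_conv_sums:
  "(\<lambda>k. fps_const (f (Suc k) / of_nat (xi (Suc k))) * fps_compose (formal_egf g) (fps_X ^ Suc k))
     sums formal_egf (binom_conv f g)"
  unfolding sums_def
proof (rule tendsto_fpsI)
  fix n
  let ?F = "\<lambda>k. fps_const (f (Suc k) / of_nat (xi (Suc k))) *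
    fps_compose (formal_egf g) (fps_X ^ Suc k)"
  \<comment> \<open>The guard \<open>n > 0\<close> matters because every \<open>d\<close> divides
    \<open>0\<close>, while the constant coefficient must vanish.\<close>
  define t where "t d = (if n > 0 \<and> d dvd n
    then f d / of_nat (xi d) * (g (n div d) / of_nat (xi (n div d))) else 0)" for d
  have "fps_nth (\<Sum>k<K. ?F k) n = fps_nth (formal_egf (binom_conv f g)) n" if "K \<ge> n" for K
  proof -
    have "fps_nth (\<Sum>k<K. ?F k) n = (\<Sum>k<K. t (Suc k))"
      unfolding fps_sum_nth fps_mult_left_const_nth
      by (intro sum.cong) (simp_all add: formal_egf_compose_X_power_nth t_def del: power_Suc)
    also have "\<dots> = (\<Sum>d\<in>{1..K}. t d)"
      by (rule sum.reindex_bij_witness[of _ "\<lambda>d. d - 1" Suc]) auto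
    also have "\<dots> = fps_nth (formal_egf (binom_conv f g)) n"
    proof (cases "n = 0")
      case False
      have "(\<Sum>d\<in>{1..K}. t d) = (\<Sum>d | d dvd n. t d)"
        using False that
        by (intro sum.mono_neutral_right) (auto simp: t_def Suc_le_eq
              intro!: Nat.gr0I order_trans[OF dvd_imp_le, of _ n K])
      with False show ?thesis
        by (simp add: formal_egf_def binom_conv_div_xi t_def)
    qed (simp add: t_def formal_egf_def)
    finally show ?thesis .
  qed
  then show "eventually (\<lambda>K. fps_nth (\<Sum>k<K. ?F k) n = fps_nth (formal_egf (binom_conv f g)) n)
      sequentially"
    by (auto simp: eventually_sequentially)
qed

theorem theorem6p1:
  fixes f g :: "nat \<Rightarrow> complex" and z :: complex
  shows
    "((\<lambda>(m, n). norm (f m * g n / (of_nat (xi m) * of_nat (xi n)) * z ^ (m * n)))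
         summable_on ({1..} \<times> {1..}) \<longrightarrow>
       summable (\<lambda>n. norm (egf_term (binom_conv f g) z (Suc n))) \<and>
       (\<forall>k\<ge>1. f k \<noteq> 0 \<longrightarrow> summable (\<lambda>n. norm (egf_term g (z ^ k) (Suc n)))) \<and>
       summable (\<lambda>k. norm (f (Suc k) / of_nat (xi (Suc k)) * egf g (z ^ Suc k))) \<and>
       egf (binom_conv f g) z = (\<Sum>k. f (Suc k) / of_nat (xi (Suc k)) * egf g (z ^ Suc k)))
     \<and>
     (\<lambda>k. fps_const (f (Suc k) / of_nat (xi (Suc k))) * fps_compose (formal_egf g) (fps_X ^ Suc k))
       sums formal_egf (binom_conv f g)"
proof (rule conjI[OF impI formal_egf_binom_conv_sums])
  define h where "h = (\<lambda>(m, n). f m * g n / (of_nat (xi m) * of_nat (xi n)) * z ^ (m * n))"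
  \<comment> \<open>The same terms as \<open>h\<close>, indexed by the product \<open>n\<close> and
    its divisor \<open>d\<close>.\<close>
  define H where "H = (\<lambda>x. h (case x of (n, d) \<Rightarrow> (d, n div d)))"
  assume "(\<lambda>(m, n). norm (f m * g n / (of_nat (xi m) * of_nat (xi n)) * z ^ (m * n)))
         summable_on ({1..} \<times> {1..})"
  then have h: "(\<lambda>x. norm (h x)) summable_on {1..} \<times> {1..}"
    by (simp add: h_def case_prod_unfold)
  have h_row: "h (k, n) = f k / of_nat (xi k) * egf_term g (z ^ k) n" for k n
    by (simp add: h_def egf_term_def power_mult)
  \<comment> \<open>Summability of row \<open>k\<close> carries over to the series of
    \<open>g\<close> only after cancelling the factor \<open>f k / xi k\<close>, hence
    \<open>f k\<close> \<noteq> \<open>0\<close>.\<close>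
  have row: "(\<lambda>n. norm (egf_term g (z ^ k) n)) summable_on {1..}" if "k \<ge> 1" "f k \<noteq> 0" for k
  proof -
    have "(\<lambda>n. norm (h (k, n))) summable_on {1..}"
      using h that(1) by (subst (asm) Infinite_Sum.abs_summable_on_Sigma_iff) auto
    then show ?thesis
      unfolding h_row norm_mult
      by (subst (asm) summable_on_cmult_right') (use that(2) in auto)
  qed
  have infsum_row: "infsum (\<lambda>n. h (k, n)) {1..} = f k / of_nat (xi k) * egf g (z ^ k)"
    if "k \<ge> 1" for k
  \<comment> \<open>If \<open>f k = 0\<close>, both sides are \<open>0\<close>, whatever value
    \<open>egf g (z ^ k)\<close> has, even when its series diverges.\<close>
  proof (cases "f k = 0")
    case False
    show ?thesis
      by (simp only: h_row infsum_cmult_right' infsum_atLeast_1[OF row[OF that False]] egf_def)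
  qed (simp add: h_row)
  have rows: "(\<lambda>k. norm (f k / of_nat (xi k) * egf g (z ^ k))) summable_on {1..}"
    using abs_summable_on_infsum_Sigma[OF h]
    by (rule summable_on_cong[THEN iffD1, rotated]) (simp only: infsum_row atLeast_iff)

  have H: "(\<lambda>x. norm (H x)) summable_on (SIGMA n:{1..}. {d. d dvd n})"
    unfolding H_def using h summable_on_reindex_bij_betw[OF bij_betw_divisor_pairs, of "\<lambda>x. norm (h x)"]
    by simp
  have hyperbola: "infsum (\<lambda>d. H (n, d)) {d. d dvd n} = egf_term (binom_conv f g) z n"
    if "n \<ge> 1" for n
  proof -
    have "finite {d. d dvd n}" using that by simp
    then have "infsum (\<lambda>d. H (n, d)) {d. d dvd n} = (\<Sum>d | d dvd n. H (n, d))"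
      by simp
    \<comment> \<open>On the hyperbola the exponent \<open>d * (n div d)\<close> is constantly
      \<open>n\<close>, so \<open>z ^ n\<close> factors out and a Dirichlet convolution
      remains.\<close>
    also have "\<dots> = (\<Sum>d | d dvd n. f d / of_nat (xi d) * (g (n div d) / of_nat (xi (n div d))) * z ^ n)"
      by (rule sum.cong) (auto simp: H_def h_def)
    also have "\<dots> = egf_term (binom_conv f g) z n"
      using that by (simp add: egf_term_def binom_conv_div_xi sum_distrib_right)
    finally show ?thesis .
  qed
  have hyperbolas: "(\<lambda>n. norm (egf_term (binom_conv f g) z n)) summable_on {1..}"
    using abs_summable_on_infsum_Sigma[OF H]
    by (rule summable_on_cong[THEN iffD1, rotated]) (simp only: hyperbola atLeast_iff)

  have "egf (binom_conv f g) z = infsum (egf_term (binom_conv f g) z) {1..}"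
    by (simp only: egf_def infsum_atLeast_1[OF hyperbolas])
  also have "\<dots> = infsum (\<lambda>n. infsum (\<lambda>d. H (n, d)) {d. d dvd n}) {1..}"
    by (rule infsum_cong) (simp only: hyperbola atLeast_iff)
  also have "\<dots> = infsum H (SIGMA n:{1..}. {d. d dvd n})"
    by (rule infsum_Sigma_banach[OF abs_summable_summable[OF H]])
  also have "\<dots> = infsum h ({1..} \<times> {1..})"
    unfolding H_def by (rule infsum_reindex_bij_betw[OF bij_betw_divisor_pairs])
  also have "\<dots> = infsum (\<lambda>k. infsum (\<lambda>n. h (k, n)) {1..}) {1..}"
    by (rule infsum_Sigma_banach[OF abs_summable_summable[OF h], symmetric])
  also have "\<dots> = infsum (\<lambda>k. f k / of_nat (xi k) * egf g (z ^ k)) {1..}"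
    by (rule infsum_cong) (simp only: infsum_row atLeast_iff)
  also have "\<dots> = (\<Sum>k. f (Suc k) / of_nat (xi (Suc k)) * egf g (z ^ Suc k))"
    by (rule infsum_atLeast_1[OF rows])
  finally have "egf (binom_conv f g) z = \<dots>" .
  then show "summable (\<lambda>n. norm (egf_term (binom_conv f g) z (Suc n))) \<and>
       (\<forall>k\<ge>1. f k \<noteq> 0 \<longrightarrow> summable (\<lambda>n. norm (egf_term g (z ^ k) (Suc n)))) \<and>
       summable (\<lambda>k. norm (f (Suc k) / of_nat (xi (Suc k)) * egf g (z ^ Suc k))) \<and>
       egf (binom_conv f g) z = (\<Sum>k. f (Suc k) / of_nat (xi (Suc k)) * egf g (z ^ Suc k))"
    using hyperbolas rows row unfolding abs_summable_on_atLeast_1_iff by blast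
qed

end
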